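(* Let $\Lambda = A\mathds Z^d$, with $A\in \mathds R^{d\times d}$ regular, $d\in\{1,2,3\}$. Then the Axilrod-Teller-Muto cohesive energy can be rewritten in terms of three-body zeta functions as \[ E^{(3)}_\mathrm{coh} = \frac{1}{24}\zeta_\Lambda^{(3)}(3,3,3) - \frac{3}{16} \zeta_\Lambda^{(3)}(-1,5,5)+\frac{3}{8} \zeta_\Lambda^{(3)}(1,3,5). \]
   Context: For a trimer with relative vectors $\bm x,\bm y\in\mathds R^d$ and $\bm z=\bm y-\bm x$, the ATM potential is \[ U^{(3)}_{\mathrm{ATM}}(\bm x,\bm y) = \vert \bm x \vert^{-3}\vert \bm y \vert^{-3}\vert \bm z\vert^{-3} - 3 \frac{(\bm x\cdot \bm y)(\bm y\cdot \bm z)(\bm z\cdot \bm x)}{\vert \bm x \vert^{5}\vert \bm y \vert^{5}\vert \bm z\vert^{5}}, \] and the cohesive energy per particle is $E_{\mathrm{coh}}^{(3)} = \frac{1}{6}{\sum_{\bm x,\bm y \in \Lambda}}' U^{(3)}_{\mathrm{ATM}}(\bm x,\bm y)$, where the primed sum excludes $\bm x=\bm 0$, $\bm y=\bm 0$, and $\bm x=\bm y$. The three-body zeta function is $\zeta_\Lambda^{(3)}(\nu_1,\nu_2,\nu_3)={\sum_{\bm x^{(1)},\bm x^{(2)}\in\Lambda}}' |\bm x^{(1)}|^{-\nu_1}|\bm x^{(2)}-\bm x^{(1)}|^{-\nu_2}|\bm x^{(2)}|^{-\nu_3}$ (primed sum excluding vanishing distances), defined for $\mathrm{Re}(\nu_i)>d$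 and meromorphically continued to $\nu_i\in\mathds C$ (via the representation $V_\Lambda\int_{\mathrm{BZ}}\prod_i Z_{\Lambda,\nu_i}(\bm k)\,\mathrm d\bm k$ with Hadamard regularization, $Z_{\Lambda,\nu}$ the Epstein zeta function); the values at $(-1,5,5)$ and $(1,3,5)$ are understood in this sense. *)

theory Defs
  imports "HOL-Analysis.Analysis"
begin

text \<open>The lattice \<Lambda> = A Z^d, with the dimension d = CARD('n).\<close>
definition lattice :: "real^'n^'n \<Rightarrow> (real^'n) set" where
  "lattice A = range (\<lambda>k::int^'n. A *v (\<chi> i. of_int (k $ i)))"

text \<open>Index set of the primed double sum: x, y in \<Lambda>, x \<noteq> 0, y \<noteq> 0, x \<noteq> y.\<close>
definition pairs3 :: "real^'n^'n \<Rightarrow> ((real^'n) \<times> (real^'n)) set" where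
  "pairs3 A = {(x, y). x \<in> lattice A \<and> y \<in> lattice A \<and> x \<noteq> 0 \<and> y \<noteq> 0 \<and> x \<noteq> y}"

text \<open>Three-body zeta function as the (unconditional) lattice sum.\<close>
definition zeta3 :: "real^'n^'n \<Rightarrow> real \<Rightarrow> real \<Rightarrow> real \<Rightarrow> real" where
  "zeta3 A \<nu>1 \<nu>2 \<nu>3 =
     (\<Sum>\<^sub>\<infinity>(x, y)\<in>pairs3 A.
        norm x powr (-\<nu>1) * norm (y - x) powr (-\<nu>2) * norm y powr (-\<nu>3))"

text \<open>Axilrod-Teller-Muto three-body potential.\<close>
definition U_ATM :: "real^'n \<Rightarrow> real^'n \<Rightarrow> real" where
  "U_ATM x y = (let z = y - x in
     norm x powr (-3) * norm y powr (-3) * norm z powr (-3)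
     - 3 * ((x \<bullet> y) * (y \<bullet> z) * (z \<bullet> x)) /
           (norm x ^ 5 * norm y ^ 5 * norm z ^ 5))"

definition E_coh3 :: "real^'n^'n \<Rightarrow> real" where
  "E_coh3 A = 1/6 * (\<Sum>\<^sub>\<infinity>(x, y)\<in>pairs3 A. U_ATM x y)"

end

theory Submission
  imports Defs
begin

text \<open>
  With side lengths a = |x|, b = |y|, c = |y - x| of the triangle 0, x, y, the inner products in
  the ATM potential are (a^2 + b^2 - c^2)/2 and its cyclic analogues, so
  U(x, y) = 1/4 (abc)^-3 - 3/8 (sum of a/(bc)^5) + 3/8 (sum over all permutations of 1/(a b^3 c^5)).
  The involutions (x, y) \<mapsto> (y, x) and (x, y) \<mapsto> (-x, y - x) of the index set permute the
  three sides, so every summand on the right sums to one of \<zeta>(3,3,3), \<zeta>(-1,5,5), \<zeta>(1,3,5),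
  giving 6 E = 1/4 \<zeta>(3,3,3) - 9/8 \<zeta>(-1,5,5) + 9/4 \<zeta>(1,3,5).

  All sums converge absolutely for d \<le> 3 (so the infsums are genuine values, not the junk 0):
  each summand is bounded by products of t^-4 + t^-5 in two of the sides, and lattice sums of
  |v|^-s converge for s > d, since |A k|^-s is dominated by a multiple of the product of the
  one-dimensional summable weights (1 + |k_i|)^(-s/d).
\<close>

lemma summable_on_int_powr:
  fixes \<alpha> :: real
  assumes "\<alpha> > 1"
  shows "(\<lambda>m::int. (1 + \<bar>of_int m\<bar>) powr (-\<alpha>)) summable_on UNIV"
proof -
  let ?f = "\<lambda>m::int. (1 + \<bar>of_int m\<bar>) powr (-\<alpha>)"
  have "summable (\<lambda>n. real (Suc n) powr (-\<alpha>))"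
    using assms by (subst summable_Suc_iff) (simp add: summable_real_powr_iff)
  then have nat: "(\<lambda>n. real (Suc n) powr (-\<alpha>)) summable_on UNIV"
    by (subst summable_on_UNIV_nonneg_real_iff) auto
  have "?f summable_on range int"
    using nat by (subst summable_on_reindex) (auto simp: o_def add.commute)
  moreover have "?f summable_on range (\<lambda>n. - int n)"
    using nat by (subst summable_on_reindex) (auto simp: inj_on_def o_def add.commute)
  ultimately have "?f summable_on range int \<union> range (\<lambda>n. - int n)"
    by (rule summable_on_union)
  moreover have "UNIV = range int \<union> range (\<lambda>n. - int n)"
  proof (rule UNIV_eq_I)
    show "m \<in> range int \<union> range (\<lambda>n. - int n)" for m
      by (cases m rule: int_cases2) auto
  qed
  ultimately show ?thesis
    by simp
qed

lemma summable_on_vec_prod: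
  fixes f :: "'a::countable \<Rightarrow> real"
  assumes "f summable_on UNIV" and "\<And>a. f a \<ge> 0"
  shows "(\<lambda>k::'a^'n. \<Prod>i\<in>UNIV. f (k $ i)) summable_on UNIV"
proof -
  have "Infinite_Set_Sum.abs_summable_on (\<lambda>g. \<Prod>i\<in>UNIV. f (g i)) (PiE (UNIV::'n set) (\<lambda>_. UNIV))"
    using assms by (intro abs_summable_on_prod_PiE) (auto simp: abs_summable_equivalent[symmetric])
  then have "(\<lambda>g. \<Prod>i\<in>UNIV. f (g i)) summable_on (UNIV :: ('n \<Rightarrow> 'a) set)"
    using assms(2) by (simp add: abs_summable_equivalent[symmetric] PiE_UNIV prod_nonneg)
  moreover have "bij_betw vec_nth (UNIV :: ('a^'n) set) UNIV"
    by (rule bij_betw_byWitness[where f' = vec_lambda]) auto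
  ultimately show ?thesis
    using summable_on_reindex_bij_betw[of vec_nth UNIV UNIV "\<lambda>g. \<Prod>i\<in>UNIV. f (g i)"] by blast
qed

definition real_of_int_vec :: "int^'n \<Rightarrow> real^'n" where
  "real_of_int_vec k = (\<chi> i. of_int (k $ i))"

lemma real_of_int_vec_diff: "real_of_int_vec (k - l) = real_of_int_vec k - real_of_int_vec l"
  by (simp add: real_of_int_vec_def vec_eq_iff)

lemma real_of_int_vec_eq_iff [simp]: "real_of_int_vec k = real_of_int_vec l \<longleftrightarrow> k = l"
  by (simp add: real_of_int_vec_def vec_eq_iff)

lemma real_of_int_vec_0 [simp]: "real_of_int_vec 0 = 0"
  by (simp add: real_of_int_vec_def vec_eq_iff)

lemma lattice_eq_range: "lattice A = range (\<lambda>k. A *v real_of_int_vec k)"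
  by (simp add: lattice_def real_of_int_vec_def)

lemma lattice_diff: "x \<in> lattice A \<Longrightarrow> y \<in> lattice A \<Longrightarrow> x - y \<in> lattice A"
  unfolding lattice_eq_range
  by (auto simp: matrix_vector_mult_diff_distrib[symmetric] real_of_int_vec_diff[symmetric])

lemma zero_in_lattice: "0 \<in> lattice A"
  unfolding lattice_eq_range by (metis matrix_vector_mult_0_right real_of_int_vec_0 rangeI)

lemma lattice_minus: "x \<in> lattice A \<Longrightarrow> - x \<in> lattice A"
  using lattice_diff[OF zero_in_lattice, of x A] by simp

lemma lattice_point_norm_powr_le:
  fixes A :: "real^'n^'n"
  assumes c: "c > 0" "\<And>x. c * norm x \<le> norm (A *v x)" and "k \<noteq> 0" "s \<ge> 0"
  shows "norm (A *v real_of_int_vec k) powr (-s)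
    \<le> (2 / c) powr s * (\<Prod>i\<in>UNIV. (1 + \<bar>real_of_int (k $ i)\<bar>) powr (-(s / CARD('n))))"
proof -
  define v where "v = A *v real_of_int_vec k"
  define W where "W = 2 * norm v / c"
  have coord_le: "c * \<bar>real_of_int (k $ i)\<bar> \<le> norm v" for i
  proof -
    have "\<bar>real_of_int (k $ i)\<bar> \<le> norm (real_of_int_vec k)"
      using component_le_norm_cart[of "real_of_int_vec k" i] by (simp add: real_of_int_vec_def)
    then have "c * \<bar>real_of_int (k $ i)\<bar> \<le> c * norm (real_of_int_vec k)"
      using c(1) by (intro mult_left_mono) auto
    also have "\<dots> \<le> norm v"
      using c(2) by (simp add: v_def)
    finally show ?thesis .
  qed
  obtain j where "k $ j \<noteq> 0"
    using \<open>k \<noteq> 0\<close> by (metis vec_eq_iff zero_index)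
  then have "1 \<le> \<bar>real_of_int (k $ j)\<bar>"
    by linarith
  from mult_left_mono[OF this, of c] have "c \<le> norm v"
    using coord_le[of j] c(1) by linarith
  then have "c * (1 + \<bar>real_of_int (k $ i)\<bar>) \<le> c * W" "c * 2 \<le> c * W" for i
    using coord_le[of i] c(1) by (simp_all add: W_def algebra_simps)
  then have W: "1 + \<bar>real_of_int (k $ i)\<bar> \<le> W" "W \<ge> 2" for i
    using c(1) by (meson mult_le_cancel_left_pos)+
  have "W powr (-s) = (\<Prod>i\<in>(UNIV::'n set). W powr (-(s / CARD('n))))"
    using W by (simp add: powr_power)
  also have "\<dots> \<le> (\<Prod>i\<in>UNIV. (1 + \<bar>real_of_int (k $ i)\<bar>) powr (-(s / CARD('n))))"
    using W \<open>s \<ge> 0\<close> by (intro prod_mono) (auto intro!: powr_mono2')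
  finally have "W powr (-s) \<le> \<dots>" .
  moreover have "norm v powr (-s) = (2 / c) powr s * W powr (-s)"
    using c(1) W by (simp add: W_def powr_divide powr_mult powr_minus field_simps)
  ultimately show ?thesis
    using c(1) by (simp add: v_def mult_left_mono)
qed

lemma lattice_norm_powr_summable:
  fixes A :: "real^'n^'n"
  assumes "invertible A" and "real CARD('n) < s"
  shows "(\<lambda>v. norm v powr (-s)) summable_on lattice A - {0}"
proof -
  define \<phi> where "\<phi> m = (1 + \<bar>real_of_int m\<bar>) powr (-(s / CARD('n)))" for m
  define h where "h k = A *v real_of_int_vec k" for k
  have "inj ((*v) A)"
    using assms(1) matrix_left_invertible_injective invertible_def by blast
  then obtain c where c: "c > 0" "\<And>x. c * norm x \<le> norm (A *v x)"
    using linear_inj_bounded_below_pos[of "(*v) A"] by blast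
  have "inj h"
    using \<open>inj ((*v) A)\<close> unfolding h_def inj_def by (metis real_of_int_vec_eq_iff)
  have lattice_h: "lattice A - {0} = h ` (UNIV - {0})"
    using \<open>inj h\<close> by (simp add: lattice_eq_range h_def[symmetric] image_set_diff) (simp add: h_def)
  have "(\<lambda>k. \<Prod>i\<in>UNIV. \<phi> (k $ i)) summable_on UNIV"
    using assms(2) by (intro summable_on_vec_prod) (auto simp: \<phi>_def intro!: summable_on_int_powr)
  then have "(\<lambda>k. (2 / c) powr s * (\<Prod>i\<in>UNIV. \<phi> (k $ i))) summable_on UNIV - {0}"
    by (intro summable_on_subset[OF summable_on_cmult_right]) auto
  then have "(\<lambda>k. norm (h k) powr (-s)) summable_on UNIV - {0}"
    by (rule summable_on_comparison_test)
       (use assms(2) in \<open>auto simp: h_def \<phi>_def intro!: lattice_point_norm_powr_le[OF c]\<close>)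
  then show ?thesis
    unfolding lattice_h using \<open>inj h\<close> by (subst summable_on_reindex) (auto simp: o_def intro: inj_on_subset)
qed

lemma summable_on_Times_mult:
  fixes f :: "'a \<Rightarrow> real" and g :: "'b \<Rightarrow> real"
  assumes "f summable_on S" "g summable_on T" "\<And>x. x \<in> S \<Longrightarrow> f x \<ge> 0" "\<And>y. y \<in> T \<Longrightarrow> g y \<ge> 0"
  shows "(\<lambda>(x, y). f x * g y) summable_on S \<times> T"
proof (rule summable_on_SigmaI[where g = "\<lambda>x. f x * infsum g T"])
  show "((\<lambda>y. (\<lambda>(x, y). f x * g y) (x, y)) has_sum f x * infsum g T) T" for x
    using assms(2) by (auto intro!: has_sum_cmult_right)
  show "(\<lambda>x. f x * infsum g T) summable_on S"
    using assms(1) by (rule summable_on_cmult_left)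
qed (use assms in auto)

lemma summable_on_pairs3_mult:
  fixes f g :: "real^'n \<Rightarrow> real"
  assumes "f summable_on lattice A - {0}" "g summable_on lattice A - {0}"
    and "\<And>v. f v \<ge> 0" "\<And>v. g v \<ge> 0"
  shows "(\<lambda>(x, y). f x * g y) summable_on pairs3 A"
    and "(\<lambda>(x, y). f x * g (y - x)) summable_on pairs3 A"
    and "(\<lambda>(x, y). f (y - x) * g y) summable_on pairs3 A"
proof -
  let ?L = "lattice A - {0}" and ?G = "\<lambda>(u, v). f u * g v"
  have G: "?G summable_on ?L \<times> ?L"
    using assms by (intro summable_on_Times_mult) auto
  show "(\<lambda>(x, y). f x * g y) summable_on pairs3 A"
    by (rule summable_on_subset[OF G]) (auto simp: pairs3_def)
  have reindex: "(?G \<circ> m) summable_on pairs3 A"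
    if "inj_on m (pairs3 A)" "m ` pairs3 A \<subseteq> ?L \<times> ?L" for m
    using summable_on_subset[OF G that(2)] summable_on_reindex[OF that(1), of ?G] by simp
  have "(?G \<circ> (\<lambda>(x, y). (x, y - x))) summable_on pairs3 A"
    by (rule reindex) (auto simp: pairs3_def inj_on_def lattice_diff)
  then show "(\<lambda>(x, y). f x * g (y - x)) summable_on pairs3 A"
    by (simp add: o_def split_def)
  have "(?G \<circ> (\<lambda>(x, y). (y - x, y))) summable_on pairs3 A"
    by (rule reindex) (auto simp: pairs3_def inj_on_def lattice_diff)
  then show "(\<lambda>(x, y). f (y - x) * g y) summable_on pairs3 A"
    by (simp add: o_def split_def)
qed

definition decay :: "real \<Rightarrow> real" where
  "decay t = 1 / t ^ 4 + 1 / t ^ 5"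

definition triangle_decay :: "real \<Rightarrow> real \<Rightarrow> real \<Rightarrow> real" where
  "triangle_decay a b c = decay a * decay b + decay b * decay c + decay c * decay a"

lemma decay_nonneg: "t \<ge> 0 \<Longrightarrow> decay t \<ge> 0"
  by (simp add: decay_def)

lemma decay_norm_summable:
  fixes A :: "real^'n^'n"
  assumes "invertible A" and "CARD('n) \<le> 3"
  shows "(\<lambda>v. decay (norm v)) summable_on lattice A - {0}"
proof -
  have "(\<lambda>v. norm v powr (-4) + norm v powr (-5)) summable_on lattice A - {0}"
    using assms by (intro summable_on_add lattice_norm_powr_summable) auto
  then show ?thesis
    by (rule summable_on_cong[THEN iffD1, rotated])
       (simp add: decay_def powr_minus divide_inverse powr_realpow)
qed

lemma triangle_decay_summable:
  fixes A :: "real^'n^'n"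
  assumes "invertible A" and "CARD('n) \<le> 3"
  shows "(\<lambda>(x, y). triangle_decay (norm x) (norm y) (norm (y - x))) summable_on pairs3 A"
proof -
  note S = summable_on_pairs3_mult[OF decay_norm_summable[OF assms] decay_norm_summable[OF assms]
      decay_nonneg[OF norm_ge_zero] decay_nonneg[OF norm_ge_zero]]
  have "(\<lambda>p. (\<lambda>(x, y). decay (norm x) * decay (norm y)) p
      + (\<lambda>(x, y). decay (norm (y - x)) * decay (norm y)) p
      + (\<lambda>(x, y). decay (norm x) * decay (norm (y - x))) p) summable_on pairs3 A"
    using S by (intro summable_on_add)
  then show ?thesis
    by (rule summable_on_cong[THEN iffD1, rotated]) (auto simp: triangle_decay_def ac_simps)
qed

lemma inverse_power_le_decay_mult:
  assumes "p > 0" "q > 0"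
  shows "1 / (p ^ 4 * q ^ 5) \<le> decay p * decay q"
proof -
  have "1 / (p ^ 4 * q ^ 5) = (1 / p ^ 4) * (1 / q ^ 5)"
    by simp
  also have "\<dots> \<le> decay p * decay q"
    using assms by (intro mult_mono) (auto simp: decay_def)
  finally show ?thesis .
qed

lemma triangle_decay_terms_nonneg:
  assumes "a > 0" "b > 0" "c > 0"
  shows "decay a * decay b \<ge> 0" "decay b * decay c \<ge> 0" "decay c * decay a \<ge> 0"
  using assms by (auto intro!: mult_nonneg_nonneg decay_nonneg)

lemma inverse_cube_le_triangle_decay:
  assumes "a > 0" "b > 0" "c > 0"
  shows "1 / (a ^ 3 * c ^ 3 * b ^ 3) \<le> triangle_decay a b c"
proof -
  have max_bound: "1 / (p ^ 3 * q ^ 3 * r ^ 3) \<le> decay p * decay q"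
    if "0 < p" "0 < q" "p \<le> r" "q \<le> r" for p q r :: real
  proof -
    have "p * q ^ 2 \<le> r * r ^ 2"
      using that by (intro mult_mono power_mono) auto
    then have "p ^ 4 * q ^ 5 \<le> p ^ 3 * q ^ 3 * r ^ 3"
      using that mult_left_mono[of "p * q ^ 2" "r * r ^ 2" "p ^ 3 * q ^ 3"]
      by (simp add: power_numeral_reduce)
    then have "1 / (p ^ 3 * q ^ 3 * r ^ 3) \<le> 1 / (p ^ 4 * q ^ 5)"
      using that by (intro divide_left_mono) auto
    with inverse_power_le_decay_mult[OF that(1,2)] show ?thesis by linarith
  qed
  consider "b \<le> a" "c \<le> a" | "a \<le> b" "c \<le> b" | "a \<le> c" "b \<le> c"
    by linarith
  then show ?thesis
  proof cases
    case 1
    then show ?thesis using max_bound[of b c a] triangle_decay_terms_nonneg[OF assms] assms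
      by (simp add: triangle_decay_def ac_simps)
  next
    case 2
    then show ?thesis using max_bound[of a c b] triangle_decay_terms_nonneg[OF assms] assms
      by (simp add: triangle_decay_def ac_simps)
  next
    case 3
    then show ?thesis using max_bound[of a b c] triangle_decay_terms_nonneg[OF assms] assms
      by (simp add: triangle_decay_def ac_simps)
  qed
qed

lemma side_over_fifth_powers_le_triangle_decay:
  assumes "a > 0" "b > 0" "c > 0" "a \<le> b + c"
  shows "a / (c ^ 5 * b ^ 5) \<le> triangle_decay a b c"
proof -
  have "a / (c ^ 5 * b ^ 5) \<le> (b + c) / (c ^ 5 * b ^ 5)"
    using assms by (intro divide_right_mono) auto
  also have "\<dots> = 1 / (b ^ 4 * c ^ 5) + 1 / (b ^ 5 * c ^ 4)"
    using assms by (simp add: field_simps power_numeral_reduce)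
  also have "\<dots> \<le> decay b * decay c"
  proof -
    have "decay b * decay c = 1 / (b ^ 4 * c ^ 4) + 1 / (b ^ 4 * c ^ 5) + 1 / (b ^ 5 * c ^ 4) + 1 / (b ^ 5 * c ^ 5)"
      by (simp add: decay_def algebra_simps)
    moreover have "1 / (b ^ 4 * c ^ 4) \<ge> 0" "1 / (b ^ 5 * c ^ 5) \<ge> 0"
      using assms by auto
    ultimately show ?thesis by linarith
  qed
  finally show ?thesis
    using triangle_decay_terms_nonneg[OF assms(1-3)] by (simp add: triangle_decay_def)
qed

lemma inverse_1_3_5_le_triangle_decay:
  assumes "a > 0" "b > 0" "c > 0"
  shows "1 / (a * c ^ 3 * b ^ 5) \<le> triangle_decay a b c"
proof -
  have "1 / (a * c ^ 3 * b ^ 5) \<le> 1 / (min a c ^ 4 * b ^ 5)"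
    using assms by (intro divide_left_mono mult_right_mono)
      (auto simp: min_def power_numeral_reduce intro!: mult_mono)
  also have "\<dots> \<le> decay a * decay b + decay c * decay b"
    using inverse_power_le_decay_mult[of "min a c" b] triangle_decay_terms_nonneg[OF assms] assms
    by (auto simp: min_def mult.commute)
  finally show ?thesis
    using triangle_decay_terms_nonneg[OF assms] by (simp add: triangle_decay_def ac_simps)
qed

definition zeta_term :: "real \<Rightarrow> real \<Rightarrow> real \<Rightarrow> (real^'n) \<times> (real^'n) \<Rightarrow> real" where
  "zeta_term \<nu>1 \<nu>2 \<nu>3 = (\<lambda>(x, y). norm x powr (-\<nu>1) * norm (y - x) powr (-\<nu>2) * norm y powr (-\<nu>3))"

lemma zeta3_eq_infsum: "zeta3 A \<nu>1 \<nu>2 \<nu>3 = infsum (zeta_term \<nu>1 \<nu>2 \<nu>3) (pairs3 A)"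
  by (simp add: zeta3_def zeta_term_def)

lemma has_sum_zeta_term_swap13:
  "(zeta_term \<nu>1 \<nu>2 \<nu>3 has_sum z) (pairs3 A) \<longleftrightarrow> (zeta_term \<nu>3 \<nu>2 \<nu>1 has_sum z) (pairs3 A)"
  by (rule has_sum_reindex_bij_witness[where i = prod.swap and j = prod.swap])
     (auto simp: pairs3_def zeta_term_def norm_minus_commute)

lemma has_sum_zeta_term_swap23:
  "(zeta_term \<nu>1 \<nu>2 \<nu>3 has_sum z) (pairs3 A) \<longleftrightarrow> (zeta_term \<nu>1 \<nu>3 \<nu>2 has_sum z) (pairs3 A)"
  by (rule has_sum_reindex_bij_witness[where i = "\<lambda>(x, y). (- x, y - x)" and j = "\<lambda>(x, y). (- x, y - x)"])
     (auto simp: pairs3_def zeta_term_def lattice_minus lattice_diff)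

lemma has_sum_zeta3_if_dominated:
  fixes A :: "real^'n^'n"
  assumes "invertible A" and "CARD('n) \<le> 3"
    and "\<And>x y. (x, y) \<in> pairs3 A \<Longrightarrow>
           zeta_term \<nu>1 \<nu>2 \<nu>3 (x, y) \<le> triangle_decay (norm x) (norm y) (norm (y - x))"
  shows "(zeta_term \<nu>1 \<nu>2 \<nu>3 has_sum zeta3 A \<nu>1 \<nu>2 \<nu>3) (pairs3 A)"
proof -
  have "zeta_term \<nu>1 \<nu>2 \<nu>3 summable_on pairs3 A"
    by (rule summable_on_comparison_test[OF triangle_decay_summable[OF assms(1,2)]])
       (use assms(3) in \<open>auto simp: zeta_term_def\<close>)
  then show ?thesis
    by (simp add: zeta3_eq_infsum)
qed

lemma pairs3_norms_pos: "(x, y) \<in> pairs3 A \<Longrightarrow> norm x > 0 \<and> norm y > 0 \<and> norm (y - x) > 0"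
  by (auto simp: pairs3_def)

lemma has_sum_zeta3_ATM:
  fixes A :: "real^'n^'n"
  assumes "invertible A" and "CARD('n) \<le> 3"
  shows "(zeta_term 3 3 3 has_sum zeta3 A 3 3 3) (pairs3 A)"
    and "(zeta_term (-1) 5 5 has_sum zeta3 A (-1) 5 5) (pairs3 A)"
    and "(zeta_term 1 3 5 has_sum zeta3 A 1 3 5) (pairs3 A)"
proof -
  have explicit:
    "zeta_term 3 3 3 (x, y) = 1 / (norm x ^ 3 * norm (y - x) ^ 3 * norm y ^ 3)"
    "zeta_term (-1) 5 5 (x, y) = norm x / (norm (y - x) ^ 5 * norm y ^ 5)"
    "zeta_term 1 3 5 (x, y) = 1 / (norm x * norm (y - x) ^ 3 * norm y ^ 5)" for x y :: "real^'n"
    by (simp_all add: zeta_term_def powr_minus divide_inverse mult.assoc)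
  show "(zeta_term 3 3 3 has_sum zeta3 A 3 3 3) (pairs3 A)"
    using assms by (intro has_sum_zeta3_if_dominated)
      (auto simp: explicit dest!: pairs3_norms_pos intro: inverse_cube_le_triangle_decay)
  show "(zeta_term (-1) 5 5 has_sum zeta3 A (-1) 5 5) (pairs3 A)"
    using assms by (intro has_sum_zeta3_if_dominated)
      (auto simp: explicit dest!: pairs3_norms_pos intro!: side_over_fifth_powers_le_triangle_decay
        norm_triangle_ineq4[of y "y - x" for x y, simplified])
  show "(zeta_term 1 3 5 has_sum zeta3 A 1 3 5) (pairs3 A)"
    using assms by (intro has_sum_zeta3_if_dominated)
      (auto simp: explicit dest!: pairs3_norms_pos intro: inverse_1_3_5_le_triangle_decay)
qed

lemma U_ATM_eq_zeta_terms:
  fixes x y :: "real^'n"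
  assumes "x \<noteq> 0" "y \<noteq> 0" "x \<noteq> y"
  shows "U_ATM x y = 1/4 * zeta_term 3 3 3 (x, y)
    - 3/8 * (zeta_term (-1) 5 5 (x, y) + zeta_term 5 (-1) 5 (x, y) + zeta_term 5 5 (-1) (x, y))
    + 3/8 * (zeta_term 1 3 5 (x, y) + zeta_term 1 5 3 (x, y) + zeta_term 3 1 5 (x, y)
           + zeta_term 3 5 1 (x, y) + zeta_term 5 1 3 (x, y) + zeta_term 5 3 1 (x, y))"
proof -
  define a b c where "a = norm x" and "b = norm y" and "c = norm (y - x)"
  have pos: "a > 0" "b > 0" "c > 0"
    using assms by (auto simp: a_def b_def c_def)
  have xy: "x \<bullet> y = (a^2 + b^2 - c^2) / 2"
    by (simp add: a_def b_def c_def power2_norm_eq_inner inner_diff_left inner_diff_right inner_commute)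
  have yz: "y \<bullet> (y - x) = (b^2 + c^2 - a^2) / 2" and zx: "(y - x) \<bullet> x = (b^2 - c^2 - a^2) / 2"
    using xy by (simp_all add: a_def b_def power2_norm_eq_inner inner_diff_left inner_diff_right inner_commute)
  show ?thesis
    unfolding U_ATM_def Let_def xy yz zx zeta_term_def
    using pos by (simp add: a_def[symmetric] b_def[symmetric] c_def[symmetric] powr_minus field_simps) algebra
qed

lemma has_sum_U_ATM:
  assumes "(zeta_term 3 3 3 has_sum z1) (pairs3 A)"
    and "(zeta_term (-1) 5 5 has_sum z2) (pairs3 A)"
    and "(zeta_term 1 3 5 has_sum z3) (pairs3 A)"
  shows "((\<lambda>(x, y). U_ATM x y) has_sum 1/4 * z1 - 9/8 * z2 + 9/4 * z3) (pairs3 A)"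
proof -
  have z2: "(zeta_term (-1) 5 5 has_sum z2) (pairs3 A)" "(zeta_term 5 (-1) 5 has_sum z2) (pairs3 A)"
    "(zeta_term 5 5 (-1) has_sum z2) (pairs3 A)"
    using assms(2) has_sum_zeta_term_swap13 has_sum_zeta_term_swap23 by blast+
  have z3: "(zeta_term 1 3 5 has_sum z3) (pairs3 A)" "(zeta_term 1 5 3 has_sum z3) (pairs3 A)"
    "(zeta_term 3 1 5 has_sum z3) (pairs3 A)" "(zeta_term 3 5 1 has_sum z3) (pairs3 A)"
    "(zeta_term 5 1 3 has_sum z3) (pairs3 A)" "(zeta_term 5 3 1 has_sum z3) (pairs3 A)"
    using assms(3) has_sum_zeta_term_swap13 has_sum_zeta_term_swap23 by blast+
  have "((\<lambda>p. 1/4 * zeta_term 3 3 3 p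
      + (-3/8) * (zeta_term (-1) 5 5 p + zeta_term 5 (-1) 5 p + zeta_term 5 5 (-1) p)
      + 3/8 * (zeta_term 1 3 5 p + zeta_term 1 5 3 p + zeta_term 3 1 5 p
             + zeta_term 3 5 1 p + zeta_term 5 1 3 p + zeta_term 5 3 1 p))
      has_sum 1/4 * z1 + (-3/8) * (z2 + z2 + z2) + 3/8 * (z3 + z3 + z3 + z3 + z3 + z3)) (pairs3 A)"
    by (intro has_sum_add has_sum_cmult_right assms(1) z2 z3)
  then have "((\<lambda>(x, y). U_ATM x y)
      has_sum 1/4 * z1 + (-3/8) * (z2 + z2 + z2) + 3/8 * (z3 + z3 + z3 + z3 + z3 + z3)) (pairs3 A)"
    by (rule has_sum_cong[THEN iffD1, rotated]) (auto simp: pairs3_def U_ATM_eq_zeta_terms)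
  then show ?thesis
    by (simp add: algebra_simps)
qed

theorem proposition1:
  fixes A :: "real^'n^'n"
  assumes "invertible A"
    and "CARD('n) \<in> {1, 2, 3}"
  shows "E_coh3 A = 1/24 * zeta3 A 3 3 3 - 3/16 * zeta3 A (-1) 5 5 + 3/8 * zeta3 A 1 3 5"
proof -
  have "CARD('n) \<le> 3"
    using assms(2) by auto
  from has_sum_U_ATM[OF has_sum_zeta3_ATM[OF assms(1) this]]
  have "(\<Sum>\<^sub>\<infinity>(x, y)\<in>pairs3 A. U_ATM x y)
      = 1/4 * zeta3 A 3 3 3 - 9/8 * zeta3 A (-1) 5 5 + 9/4 * zeta3 A 1 3 5"
    by (rule infsumI)
  then show ?thesis
    by (simp add: E_coh3_def)
qed

end
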